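(* Let $\bm C\in\mathbb S^d_{++}$, $\bm A=[\bm a_1,\dots,\bm a_n]\in\mathbb R^{d\times n}$, $s\in[n]$, $\bm b_i:=\bm C^{-1/2}\bm a_i$ and $\bm q_i:=(\bm C+\bm A\bm A^\top)^{-1/2}\bm a_i$ for $i\in[n]$. The problem $$z^*=\log\det\bm C+\max_{\bm x\in\mathcal Z_s}\log\det\Big(\bm I_d+\sum_{i\in[n]}x_i\bm b_i\bm b_i^\top\Big)$$ is equivalent (via $\bm x\mapsto\bm 1-\bm x$, with equal objective values) to the complementary problem $$z^*=\log\det(\bm C+\bm A\bm A^\top)+\max_{\bm x\in\mathcal Z_{n-s}}\log\det\Big(\bm I_d-\sum_{i\in[n]}x_i\bm q_i\bm q_i^\top\Big),$$ and the Lagrangian dual of the continuous relaxation of the complementary problem is $$\log\det(\bm C+\bm A\bm A^\top)+\min_{\bm\Lambda\in\mathbb S^d_{++},\ \nu\in\mathbb R,\ \bm\mu\in\mathbb R^n_+}\Big\{-\log\det\bm\Lambda+\operatorname{tr}\bm\Lambda+(n-s)\nu+\sum_{i\in[n]}\mu_i-d\ :\ -\bm q_i^\top\bm\Lambda\bm q_i\le\nu+\mu_i,\ i\in[n]\Big\},$$ whose optimal value equals $$\hat z_R:=\log\det\bm C+\min_{\bm\Lambda\in\mathbb S^d_{++},\ \nu\in\mathbb R,\ \bm\mu\in\mathbb R^n_+}\Big\{-\log\det\bm\Lambda+\operatorname{tr}\bm\Lambda+s\nu+\sum_{i\in[n]}\mu_i-d\ :\ \bm b_i^\top\bm\Lambda\bm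 b_i\le\nu+\mu_i,\ i\in[n]\Big\}.$$
   Context: $[n]=\{1,\dots,n\}$; $\mathbb S^d_{++}$ is the set of symmetric positive-definite $d\times d$ matrices; square roots are positive-definite square roots; $\mathcal Z_k:=\{\bm x\in\{0,1\}^n:\sum_i x_i=k\}$; the continuous relaxation replaces $\bm x\in\{0,1\}^n$ by $\bm x\in[0,1]^n$. The Lagrangian dual of the relaxation of the complementary problem is taken with respect to the form: maximize $\log\det\bm X$ over $\bm X\in\mathbb S^d_{++}$, $\bm x\in\mathbb R^n$ subject to $\bm I_d-\sum_i x_i\bm q_i\bm q_i^\top\succeq\bm X$ (multiplier $\bm\Lambda\in\mathbb S^d_{++}$), $\sum_i x_i=n-s$ (multiplier $\nu\in\mathbb R$), $x_i\ge0$ (multipliers $\bm\upsilon\in\mathbb R^n_+$), $x_i\le1$ (multipliers $\bm\mu\in\mathbb R^n_+$), with Lagrangian $$L=\log\det\bm X+\operatorname{tr}\bm\Lambda-\operatorname{tr}(\bm X\bm\Lambda)+\sum_{i\in[n]}(-\bm q_i^\top\bm\Lambda\bm q_i-\nu+\upsilon_i-\mu_i)x_i+(n-s)\nu+\sum_{i\in[n]}\mu_i;$$ the dual (plus the constant $\log\det(\bm C+\bm A\bm A^\top)$) is $\inf_{\bm\Lambda,\nu,\bm\upsilon,\bm\mu}\sup_{\bm X\in\mathbb S^d_{++},\bm x\in\mathbb R^n}L$. The quantity $\hat z_R$ is the analogous Lagrangian dual value for the relaxation of the first problem. *)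

theory Defs
  imports "HOL-Analysis.Analysis"
begin

definition pos_def :: "(real^'d^'d) set" where
  "pos_def = {X. transpose X = X \<and> (\<forall>v. v \<noteq> 0 \<longrightarrow> 0 < v \<bullet> (X *v v))}"

definition mat_sqrt :: "real^'d^'d \<Rightarrow> real^'d^'d" where
  "mat_sqrt M = (THE R. R \<in> pos_def \<and> R ** R = M)"

text \<open>Only meaningful for \<open>det X > 0\<close>; it is applied to positive definite matrices only.
  For \<open>compl_obj\<close> on vectors with entries in [0, 1], this holds since \<open>A ** transpose A\<close> is
  dominated by \<open>C + A ** transpose A\<close> strictly.\<close>

definition logdet :: "real^'d^'d \<Rightarrow> real" where
  "logdet X = ln (det X)"

definition outer :: "real^'d \<Rightarrow> real^'d^'d" where
  "outer v = (\<chi> i j. v $ i * v $ j)"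

definition b_vec :: "real^'d^'d \<Rightarrow> real^'n^'d \<Rightarrow> 'n \<Rightarrow> real^'d" where
  "b_vec C A i = matrix_inv (mat_sqrt C) *v column i A"

definition q_vec :: "real^'d^'d \<Rightarrow> real^'n^'d \<Rightarrow> 'n \<Rightarrow> real^'d" where
  "q_vec C A i = matrix_inv (mat_sqrt (C + A ** transpose A)) *v column i A"

definition binary_vecs :: "nat \<Rightarrow> (real^'n) set" where
  "binary_vecs k = {x. (\<forall>i. x $ i \<in> {0, 1}) \<and> (\<Sum>i\<in>UNIV. x $ i) = real k}"

definition nonneg_vecs :: "(real^'n) set" where
  "nonneg_vecs = {x. \<forall>i. 0 \<le> x $ i}"

definition obj :: "real^'d^'d \<Rightarrow> real^'n^'d \<Rightarrow> real^'n \<Rightarrow> real" where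
  "obj C A x = logdet (mat 1 + (\<Sum>i\<in>UNIV. x $ i *\<^sub>R outer (b_vec C A i)))"

definition compl_obj :: "real^'d^'d \<Rightarrow> real^'n^'d \<Rightarrow> real^'n \<Rightarrow> real" where
  "compl_obj C A x = logdet (mat 1 - (\<Sum>i\<in>UNIV. x $ i *\<^sub>R outer (q_vec C A i)))"

text \<open>
  The Lagrangian of the problem: maximize \<open>logdet X\<close> over positive definite \<open>X\<close> and arbitrary \<open>x\<close>
  subject to \<open>mat 1 - (\<Sum>i\<in>UNIV. x $ i *\<^sub>R outer (q i)) - X\<close> being positive semidefinite
  (multiplier \<open>\<Lambda>\<close>), \<open>(\<Sum>i\<in>UNIV. x $ i) = k\<close> (multiplier \<open>\<nu>\<close>), \<open>x \<ge> 0\<close> (multipliers \<open>\<upsilon>\<close>)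
  and \<open>x \<le> 1\<close> (multipliers \<open>\<mu>\<close>).  The form grouped by constraints is \<open>lagrangian_alt\<close>.
\<close>

definition lagrangian ::
  "('n::finite \<Rightarrow> real^'d) \<Rightarrow> nat \<Rightarrow> real^'d^'d \<Rightarrow> real^'n \<Rightarrow>
   real^'d^'d \<Rightarrow> real \<Rightarrow> real^'n \<Rightarrow> real^'n \<Rightarrow> real" where
  "lagrangian q k X x \<Lambda> \<nu> \<upsilon> \<mu> =
     logdet X + trace \<Lambda> - trace (X ** \<Lambda>)
     + (\<Sum>i\<in>UNIV. (- (q i \<bullet> (\<Lambda> *v q i)) - \<nu> + \<upsilon> $ i - \<mu> $ i) * x $ i)
     + real k * \<nu> + (\<Sum>i\<in>UNIV. \<mu> $ i)"

lemma trace_outer_mult: "trace (outer v ** M) = v \<bullet> (M *v v)"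
proof -
  have "trace (outer v ** M) = (\<Sum>i\<in>UNIV. \<Sum>j\<in>UNIV. v $ i * v $ j * M $ j $ i)"
    by (simp add: trace_def matrix_matrix_mult_def outer_def)
  also have "\<dots> = (\<Sum>j\<in>UNIV. \<Sum>i\<in>UNIV. v $ i * v $ j * M $ j $ i)"
    by (rule sum.swap)
  also have "\<dots> = v \<bullet> (M *v v)"
    by (simp add: inner_vec_def matrix_vector_mult_def sum_distrib_left mult_ac)
  finally show ?thesis .
qed

lemma trace_sum_scaleR_mult:
  fixes F :: "'n::finite \<Rightarrow> real^'d^'d"
  shows "trace ((\<Sum>i\<in>UNIV. c i *\<^sub>R F i) ** M) = (\<Sum>i\<in>UNIV. c i * trace (F i ** M))"
proof -
  have "linear (\<lambda>X. trace (X ** M))"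
    by (rule linearI)
       (simp_all add: trace_def matrix_matrix_mult_def sum.distrib sum_distrib_left algebra_simps)
  from linear_sum[OF this, of "\<lambda>i. c i *\<^sub>R F i" UNIV] linear_cmul[OF this] show ?thesis
    by simp
qed

lemma lagrangian_alt:
  "lagrangian q k X x \<Lambda> \<nu> \<upsilon> \<mu> =
     logdet X
     + trace ((mat 1 - (\<Sum>i\<in>UNIV. x $ i *\<^sub>R outer (q i)) - X) ** \<Lambda>)
     + \<nu> * (real k - (\<Sum>i\<in>UNIV. x $ i))
     + (\<Sum>i\<in>UNIV. \<upsilon> $ i * x $ i) + (\<Sum>i\<in>UNIV. \<mu> $ i * (1 - x $ i))"
proof -
  have sub: "(P - Q) ** \<Lambda> = P ** \<Lambda> - Q ** \<Lambda>" for P Q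
    by (simp add: vec_eq_iff matrix_matrix_mult_def algebra_simps sum_subtractf)
  have add: "(P + Q) ** \<Lambda> = P ** \<Lambda> + Q ** \<Lambda>" for P Q
    by (simp add: vec_eq_iff matrix_matrix_mult_def algebra_simps sum.distrib)
  show ?thesis
    by (simp add: lagrangian_def sub add trace_add trace_sub trace_sum_scaleR_mult trace_outer_mult
        algebra_simps sum.distrib sum_subtractf sum_negf sum_distrib_left)
qed

text \<open>Values lie in the extended reals, as the inner supremum may be infinite.\<close>

definition dual_fun ::
  "('n::finite \<Rightarrow> real^'d) \<Rightarrow> nat \<Rightarrow> real^'d^'d \<Rightarrow> real \<Rightarrow> real^'n \<Rightarrow> real^'n \<Rightarrow> ereal" where
  "dual_fun q k \<Lambda> \<nu> \<upsilon> \<mu> = (SUP (X, x) \<in> pos_def \<times> UNIV. ereal (lagrangian q k X x \<Lambda> \<nu> \<upsilon> \<mu>))"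

definition lagrangian_dual :: "('n::finite \<Rightarrow> real^'d) \<Rightarrow> nat \<Rightarrow> ereal" where
  "lagrangian_dual q k =
     (INF (\<Lambda>, \<nu>, \<upsilon>, \<mu>) \<in> pos_def \<times> UNIV \<times> nonneg_vecs \<times> nonneg_vecs. dual_fun q k \<Lambda> \<nu> \<upsilon> \<mu>)"

definition dual_obj :: "nat \<Rightarrow> (real^'d^'d) \<times> real \<times> (real^'n) \<Rightarrow> real" where
  "dual_obj k = (\<lambda>(\<Lambda>, \<nu>, \<mu>).
     - logdet \<Lambda> + trace \<Lambda> + real k * \<nu> + (\<Sum>i\<in>UNIV. \<mu> $ i) - real CARD('d))"

definition dual_feasible :: "('n::finite \<Rightarrow> real^'d) \<Rightarrow> ((real^'d^'d) \<times> real \<times> (real^'n)) set" where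
  "dual_feasible b = {(\<Lambda>, \<nu>, \<mu>). \<Lambda> \<in> pos_def \<and> \<mu> \<in> nonneg_vecs \<and>
     (\<forall>i. b i \<bullet> (\<Lambda> *v b i) \<le> \<nu> + \<mu> $ i)}"

definition compl_dual_feasible :: "('n::finite \<Rightarrow> real^'d) \<Rightarrow> ((real^'d^'d) \<times> real \<times> (real^'n)) set" where
  "compl_dual_feasible q = {(\<Lambda>, \<nu>, \<mu>). \<Lambda> \<in> pos_def \<and> \<mu> \<in> nonneg_vecs \<and>
     (\<forall>i. - (q i \<bullet> (\<Lambda> *v q i)) \<le> \<nu> + \<mu> $ i)}"

definition has_min :: "('a \<Rightarrow> real) \<Rightarrow> 'a set \<Rightarrow> real \<Rightarrow> bool" where
  "has_min f S v \<longleftrightarrow> (\<exists>p\<in>S. f p = v \<and> (\<forall>p'\<in>S. v \<le> f p'))"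

end

theory Submission
  imports Defs
begin

text \<open>
  Both objectives equal \<open>logdet (C + \<Sum> x\<^sub>i a\<^sub>i a\<^sub>i\<^sup>T)\<close> after undoing the whitening, which settles the
  binary problems. In the Lagrangian, the supremum over \<open>x\<close> is finite only if \<open>\<upsilon>\<close> is the slack of the
  dual constraints, and the supremum over \<open>X\<close> is attained at \<open>\<Lambda>\<^sup>-\<^sup>1\<close> because \<open>logdet Y \<le> trace Y - d\<close>
  for positive definite \<open>Y\<close>. The two dual programs have the same value without any appeal to strong
  duality: a bijection of their feasible sets shifts the objective by a constant. Hence it suffices
  that one of them attains its minimum. After restricting to \<open>\<nu> \<ge> 0\<close>, sublevel sets are compact, as
  \<open>trace \<Lambda>\<close> is bounded above and \<open>det \<Lambda>\<close> away from 0.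
\<close>

section \<open>Positive definite matrices\<close>

lemma inner_matrix_vector_transpose:
  fixes A :: "real^'n^'m"
  shows "(A *v x) \<bullet> y = x \<bullet> (transpose A *v y)"
  using dot_lmul_matrix[of y A x] by (simp add: transpose_matrix_vector inner_commute)

text \<open>A maximizer \<open>v\<close> of the quadratic form on the unit sphere of
  \<open>S\<close> is an eigenvector: moving it along its residual
  \<open>A *v v - l *\<^sub>R v\<close>, which lies in \<open>S\<close>, would otherwise raise the
  Rayleigh quotient to first order.\<close>

lemma eigenvector_in_invariant_subspace:
  fixes A :: "real^'d^'d"
  assumes sym: "transpose A = A" and S: "subspace S" and inv: "\<And>x. x \<in> S \<Longrightarrow> A *v x \<in> S"
    and x: "x \<in> S" "x \<noteq> 0"
  shows "\<exists>v\<in>S. norm v = 1 \<and> (\<exists>l. A *v v = l *\<^sub>R v)"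
proof -
  let ?K = "S \<inter> sphere 0 1"
  have "compact ?K"
    by (simp add: S closed_subspace closed_Int_compact)
  moreover have "x /\<^sub>R norm x \<in> ?K"
    using x S by (simp add: subspace_scale)
  moreover have "continuous_on ?K (\<lambda>v. v \<bullet> (A *v v))"
    by (intro continuous_intros linear_continuous_on linear_linear[THEN iffD1]) simp
  ultimately obtain v where v: "v \<in> ?K" and max: "\<And>w. w \<in> ?K \<Longrightarrow> w \<bullet> (A *v w) \<le> v \<bullet> (A *v v)"
    using continuous_attains_sup[of ?K "\<lambda>v. v \<bullet> (A *v v)"] by blast
  define l where "l = v \<bullet> (A *v v)"
  \<comment> \<open>Homogeneity carries the maximum over the unit sphere to all of
    \<open>S\<close>.\<close>
  have bound: "w \<bullet> (A *v w) \<le> l * (w \<bullet> w)" if w: "w \<in> S" for w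
  proof (cases "w = 0")
    case False
    then have "w /\<^sub>R norm w \<in> ?K"
      using w S by (simp add: subspace_scale)
    from max[OF this] have "(w \<bullet> (A *v w)) / (norm w)\<^sup>2 \<le> l"
      by (simp add: l_def matrix_vector_mult_scaleR power2_eq_square divide_inverse mult_ac)
    then show ?thesis
      using False by (simp add: pos_divide_le_eq power2_norm_eq_inner)
  qed simp
  define u where "u = A *v v - l *\<^sub>R v"
  have uS: "u \<in> S" and vS: "v \<in> S"
    using v S inv by (auto simp: u_def subspace_diff subspace_scale)
  have vv: "v \<bullet> v = 1"
    using v by (simp add: norm_eq_1)
  have sw: "v \<bullet> (A *v u) = u \<bullet> (A *v v)"
    using inner_matrix_vector_transpose[of A v u] by (simp add: sym inner_commute)
  have uu: "u \<bullet> (A *v v) = u \<bullet> u + l * (u \<bullet> v)"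
    by (simp add: u_def algebra_simps)
  define c where "c = l * (u \<bullet> u) - u \<bullet> (A *v u)"
  \<comment> \<open>This is \<open>bound\<close> at \<open>v + t *\<^sub>R u\<close>: the constants
    and the terms in \<open>u \<bullet> v\<close> cancel, leaving a linear term in \<open>t\<close>
    against a quadratic one.\<close>
  have key: "2 * t * (u \<bullet> u) \<le> t\<^sup>2 * c" for t
  proof -
    have "(v + t *\<^sub>R u) \<bullet> (A *v (v + t *\<^sub>R u)) \<le> l * ((v + t *\<^sub>R u) \<bullet> (v + t *\<^sub>R u))"
      by (intro bound) (use uS vS S in \<open>auto simp: subspace_add subspace_scale\<close>)
    moreover have "(v + t *\<^sub>R u) \<bullet> (A *v (v + t *\<^sub>R u))
        = l + 2 * t * (u \<bullet> u + l * (u \<bullet> v)) + t\<^sup>2 * (u \<bullet> (A *v u))"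
      by (simp add: matrix_vector_right_distrib matrix_vector_mult_scaleR inner_add_left
          inner_add_right sw uu l_def[symmetric] algebra_simps power2_eq_square)
    moreover have "(v + t *\<^sub>R u) \<bullet> (v + t *\<^sub>R u) = 1 + 2 * t * (u \<bullet> v) + t\<^sup>2 * (u \<bullet> u)"
      by (simp add: inner_add_left inner_add_right vv inner_commute[of v u] algebra_simps power2_eq_square)
    ultimately show ?thesis
      by (simp only: c_def) (simp add: distrib_left right_diff_distrib mult_ac)
  qed
  have "u = 0"
  proof (rule ccontr)
    assume "u \<noteq> 0"
    then have pos: "0 < u \<bullet> u" by simp
    have "0 < c"
      using key[of 1] pos by (simp del: inner_gt_zero_iff)
    \<comment> \<open>For this \<open>t\<close> the right side of \<open>key\<close> is half of the
      positive left side.\<close>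
    then show False
      using key[of "(u \<bullet> u) / c"] mult_pos_pos[OF pos pos]
      by (simp add: power2_eq_square field_simps del: inner_gt_zero_iff)
  qed
  then have "A *v v = l *\<^sub>R v"
    by (simp add: u_def)
  then show ?thesis
    using v by auto
qed

text \<open>Induction on the dimension: by symmetry of \<open>A\<close>, the vectors of
  \<open>S\<close> orthogonal to an eigenvector again form an invariant subspace, and a strictly
  smaller one.\<close>

lemma orthonormal_eigenbasis_invariant_subspace:
  fixes A :: "real^'d^'d"
  assumes sym: "transpose A = A" and "subspace S" and "\<And>x. x \<in> S \<Longrightarrow> A *v x \<in> S"
  shows "\<exists>B. pairwise orthogonal B \<and> span B = S \<and>
    (\<forall>v\<in>B. norm v = 1 \<and> (\<exists>l. A *v v = l *\<^sub>R v))"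
  using assms(2,3)
proof (induction "dim S" arbitrary: S rule: less_induct)
  case less
  show ?case
  proof (cases "\<exists>x\<in>S. x \<noteq> 0")
    case False
    then have "S = {0}"
      using less.prems(1) subspace_0 by blast
    then show ?thesis
      by (intro exI[of _ "{}"]) simp
  next
    case True
    then obtain v l where v: "v \<in> S" "norm v = 1" "A *v v = l *\<^sub>R v"
      using eigenvector_in_invariant_subspace[OF sym less.prems] by blast
    let ?S = "{x \<in> S. x \<bullet> v = 0}"
    have sub: "subspace ?S"
      using less.prems(1) by (auto simp: subspace_def inner_add_left)
    have inv: "A *v x \<in> ?S" if "x \<in> ?S" for x
      using that less.prems(2) inner_matrix_vector_transpose[of A x v] by (simp add: sym v)
    have "v \<notin> ?S"
      using v by (simp add: norm_eq_1)
    then have "?S \<subset> S"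
      using v by blast
    then have "dim ?S < dim S"
      using dim_psubset[of ?S S] sub less.prems(1) span_eq_iff[of ?S] span_eq_iff[of S] by presburger
    then obtain B where B: "pairwise orthogonal B" "span B = ?S"
      "\<forall>v\<in>B. norm v = 1 \<and> (\<exists>l. A *v v = l *\<^sub>R v)"
      using less.hyps[OF _ sub] inv by blast
    have orth: "x \<bullet> v = 0" if "x \<in> B" for x
      using that B(2) span_base[of x B] by auto
    have "span (insert v B) = S"
    proof
      show "span (insert v B) \<subseteq> S"
        using less.prems(1) v B(2) span_superset[of B] by (intro span_minimal) auto
      show "S \<subseteq> span (insert v B)"
      proof
        fix x assume x: "x \<in> S"
        have "x - (x \<bullet> v) *\<^sub>R v \<in> ?S"
          using x v less.prems(1)
          by (auto simp: subspace_diff subspace_scale inner_diff_left norm_eq_1)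
        then have "x - (x \<bullet> v) *\<^sub>R v \<in> span B"
          by (simp only: B(2))
        then show "x \<in> span (insert v B)"
          by (auto simp: span_insert)
      qed
    qed
    moreover have "pairwise orthogonal (insert v B)"
      using B(1) orth by (auto simp: pairwise_insert orthogonal_def inner_commute)
    ultimately show ?thesis
      using B(3) v by (intro exI[of _ "insert v B"]) auto
  qed
qed

definition diag_mat :: "('d \<Rightarrow> real) \<Rightarrow> real^'d^'d" where
  "diag_mat l = (\<chi> i j. if i = j then l i else 0)"

lemma diag_mat_mult: "diag_mat k ** diag_mat l = diag_mat (\<lambda>i. k i * l i)"
  by (simp add: diag_mat_def matrix_matrix_mult_def vec_eq_iff if_distrib[of "\<lambda>x. x * _"]
      if_distrib[of "\<lambda>x. _ * x"] cong: if_cong)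

lemma det_diag_mat: "det (diag_mat l) = (\<Prod>i\<in>UNIV. l i)"
  by (subst det_diagonal) (simp_all add: diag_mat_def)

lemma trace_diag_mat: "trace (diag_mat l) = (\<Sum>i\<in>UNIV. l i)"
  by (simp add: trace_def diag_mat_def)

lemma inner_diag_mat: "v \<bullet> (diag_mat l *v v) = (\<Sum>i\<in>UNIV. l i * (v $ i)\<^sup>2)"
  by (simp add: inner_vec_def matrix_vector_mult_def diag_mat_def power2_eq_square mult_ac
      if_distrib[of "\<lambda>x. x * _"] if_distrib[of "\<lambda>x. _ * x"] cong: if_cong)

lemma inner_axis_diag_mat: "axis i 1 \<bullet> (diag_mat l *v axis i 1) = l i"
  by (simp add: inner_axis' matrix_vector_mult_basis column_def diag_mat_def)

lemma transpose_diag_mat: "transpose (diag_mat l) = diag_mat l"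
  by (simp add: transpose_def diag_mat_def vec_eq_iff)

text \<open>An orthonormal eigenbasis has \<open>CARD('d)\<close> elements, so it can be indexed by
  \<open>'d\<close> itself and used as the columns of \<open>P\<close>.\<close>

theorem symmetric_matrix_diagonalization:
  fixes A :: "real^'d^'d"
  assumes sym: "transpose A = A"
  obtains P l where "orthogonal_matrix P" "A = P ** diag_mat l ** transpose P"
proof -
  obtain B where B: "pairwise orthogonal B" "span B = UNIV"
    "\<forall>v\<in>B. norm v = 1 \<and> (\<exists>l. A *v v = l *\<^sub>R v)"
    using orthonormal_eigenbasis_invariant_subspace[OF sym subspace_UNIV] by auto
  have "0 \<notin> B"
    using B(3) by auto
  then have ind: "independent B"
    using B(1) pairwise_orthogonal_independent by blast
  then have "card B = CARD('d)" and "finite B"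
    using B(2) dim_eq_card[of B UNIV] finiteI_independent by auto
  then obtain f :: "'d \<Rightarrow> real^'d" where f: "bij_betw f UNIV B"
    using finite_same_card_bij[of "UNIV :: 'd set" B] by auto
  have fB: "f i \<in> B" for i
    using f by (auto simp: bij_betw_def)
  then have "\<forall>i. \<exists>l. A *v f i = l *\<^sub>R f i"
    using B(3) by blast
  then obtain l where l: "\<And>i. A *v f i = l i *\<^sub>R f i"
    using choice[of "\<lambda>i l. A *v f i = l *\<^sub>R f i"] by blast
  define P where "P = (\<chi> i j. f j $ i)"
  have col: "column i P = f i" for i
    by (simp add: P_def column_def vec_eq_iff)
  have orth: "orthogonal_matrix P"
    unfolding orthogonal_matrix_orthonormal_columns col
    using B(1,3) fB f by (auto simp: pairwise_def bij_betw_def inj_on_def) metis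
  have "A ** P = P ** diag_mat l"
  proof -
    have "(A ** P) $ i $ j = (A *v f j) $ i" for i j
      by (simp add: matrix_matrix_mult_def matrix_vector_mult_def P_def)
    moreover have "(P ** diag_mat l) $ i $ j = (l j *\<^sub>R f j) $ i" for i j
      by (simp add: matrix_matrix_mult_def diag_mat_def P_def if_distrib[of "\<lambda>x. _ * x"] cong: if_cong)
    ultimately show ?thesis
      by (simp add: vec_eq_iff l)
  qed
  then have "A = P ** diag_mat l ** transpose P"
    using orth by (metis matrix_mul_assoc matrix_mul_rid orthogonal_matrix_def)
  with orth show thesis
    by (rule that)
qed

section \<open>Positive definiteness, determinants and the trace bound\<close>

lemma pos_def_congruence:
  fixes X R :: "real^'d^'d"
  assumes X: "X \<in> pos_def" and R: "invertible R"
  shows "transpose R ** X ** R \<in> pos_def"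
proof -
  have "v \<bullet> ((transpose R ** X ** R) *v v) = (R *v v) \<bullet> (X *v (R *v v))" for v
    by (simp add: inner_matrix_vector_transpose matrix_vector_mul_assoc matrix_mul_assoc)
  moreover have "R *v v \<noteq> 0" if "v \<noteq> 0" for v
    using that R by (metis matrix_vector_mult_0_right invertible_def matrix_vector_mul_assoc
        matrix_vector_mul_lid)
  ultimately show ?thesis
    using X by (auto simp: pos_def_def matrix_transpose_mul matrix_mul_assoc)
qed

lemma diag_mat_pos_def_iff: "diag_mat l \<in> pos_def \<longleftrightarrow> (\<forall>i. 0 < l i)"
proof
  assume "diag_mat l \<in> pos_def"
  then have "0 < axis i 1 \<bullet> (diag_mat l *v axis i (1::real))" for i
    by (auto simp: pos_def_def axis_eq_0_iff)
  then show "\<forall>i. 0 < l i"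
    by (simp add: inner_axis_diag_mat)
next
  assume l: "\<forall>i. 0 < l i"
  have "0 < (\<Sum>i\<in>UNIV. l i * (v $ i)\<^sup>2)" if v: "v \<noteq> 0" for v :: "real^'a"
  proof -
    obtain i where "v $ i \<noteq> 0"
      using v by (auto simp: vec_eq_iff)
    then show ?thesis
      using l by (intro sum_pos2[of _ i]) (auto simp: less_imp_le)
  qed
  then show "diag_mat l \<in> pos_def"
    by (simp add: pos_def_def transpose_diag_mat inner_diag_mat)
qed

text \<open>Congruence by the orthogonal \<open>P\<close> turns \<open>X\<close> into the diagonal
  matrix, so the eigenvalues inherit positivity from \<open>X\<close>.\<close>

lemma pos_def_diagonalization:
  fixes X :: "real^'d^'d"
  assumes "X \<in> pos_def"
  obtains P l where "orthogonal_matrix P" "\<And>i. 0 < l i" "X = P ** diag_mat l ** transpose P"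
proof -
  obtain P l where P: "orthogonal_matrix P" and X: "X = P ** diag_mat l ** transpose P"
    using assms symmetric_matrix_diagonalization[of X] by (auto simp: pos_def_def)
  have "0 < l i" for i
  proof -
    have inv: "invertible P"
      using P by (auto simp: orthogonal_matrix_def invertible_def)
    have "transpose P ** X ** P = diag_mat l"
      using P unfolding X by (metis matrix_mul_assoc matrix_mul_lid matrix_mul_rid orthogonal_matrix_def)
    then have "diag_mat l \<in> pos_def"
      using pos_def_congruence[OF assms inv] by simp
    then show ?thesis
      by (simp add: diag_mat_pos_def_iff)
  qed
  with P X show thesis
    by (intro that)
qed

lemma det_pos_def:
  assumes "X \<in> pos_def"
  shows "0 < det X"
proof -
  obtain P l where "orthogonal_matrix P" "\<And>i. 0 < l i" "X = P ** diag_mat l ** transpose P"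
    using pos_def_diagonalization[OF assms] by metis
  then show ?thesis
    using det_orthogonal_matrix[of P]
    by (auto simp: det_mul det_transpose det_diag_mat intro!: prod_pos)
qed

lemma invertible_pos_def: "X \<in> pos_def \<Longrightarrow> invertible X"
  using det_pos_def[of X] by (simp add: invertible_det_nz)

text \<open>Sums \<open>ln x \<le> x - 1\<close> over the eigenvalues. Both the supremum over
  \<open>X\<close> in the Lagrangian and the coercivity of the dual objective rest on this
  bound.\<close>

lemma logdet_le_trace:
  fixes X :: "real^'d^'d"
  assumes "X \<in> pos_def"
  shows "logdet X \<le> trace X - real CARD('d)"
proof -
  obtain P l where P: "orthogonal_matrix P" and l: "\<And>i. 0 < l i"
    and X: "X = P ** diag_mat l ** transpose P"
    using pos_def_diagonalization[OF assms] by metis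
  have "det X = (\<Prod>i\<in>UNIV. l i)"
    using det_orthogonal_matrix[OF P] by (auto simp: X det_mul det_transpose det_diag_mat)
  moreover have "l i \<noteq> 0" for i
    using l[of i] by simp
  ultimately have "logdet X = (\<Sum>i\<in>UNIV. ln (l i))"
    by (simp add: logdet_def ln_prod)
  also have "\<dots> \<le> (\<Sum>i\<in>UNIV. l i - 1)"
    using l by (intro sum_mono ln_le_minus_one) auto
  also have "\<dots> = trace (diag_mat l) - real CARD('d)"
    by (simp add: trace_diag_mat sum_subtractf)
  also have "trace (diag_mat l) = trace X"
    using P unfolding X
    by (metis matrix_mul_assoc matrix_mul_rid orthogonal_matrix_def trace_mul_sym)
  finally show ?thesis .
qed

section \<open>Positive definite square roots and inverses\<close>

lemma pos_def_sqrt_unique: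
  fixes R S :: "real^'d^'d"
  assumes R: "R \<in> pos_def" and S: "S \<in> pos_def" and eq: "R ** R = S ** S"
  shows "R = S"
proof -
  let ?D = "R - S"
  have D: "transpose ?D = ?D"
    using R S by (simp add: pos_def_def transpose_def vec_eq_iff)
  then obtain P l where P: "orthogonal_matrix P" and dec: "?D = P ** diag_mat l ** transpose P"
    using symmetric_matrix_diagonalization by blast
  have "l i = 0" for i
  proof -
    let ?v = "column i P"
    have DP: "?D ** P = P ** diag_mat l"
      using P unfolding dec by (metis matrix_mul_assoc matrix_mul_rid orthogonal_matrix_def)
    have "(?D *v ?v) $ j = l i * ?v $ j" for j
    proof -
      have "(?D *v ?v) $ j = (?D ** P) $ j $ i"
        by (simp add: matrix_matrix_mult_def matrix_vector_mult_def column_def)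
      also have "\<dots> = l i * ?v $ j"
        unfolding DP by (simp add: matrix_matrix_mult_def diag_mat_def column_def
            if_distrib[of "\<lambda>x. _ * x"] cong: if_cong)
      finally show ?thesis .
    qed
    then have ev: "?D *v ?v = l i *\<^sub>R ?v"
      by (simp add: vec_eq_iff)
    have "norm ?v = 1"
      using P by (simp add: orthogonal_matrix_orthonormal_columns)
    then have "?v \<noteq> 0"
      by auto
    then have pos: "0 < ?v \<bullet> (R *v ?v)" "0 < ?v \<bullet> (S *v ?v)"
      using R S by (auto simp: pos_def_def)
    \<comment> \<open>The sum telescopes to \<open>R ** R - S ** S\<close>. Tested on an eigenvector
      of \<open>?D\<close>, it gives the eigenvalue times a positive number, so the eigenvalue is
      0.\<close>
    have "R ** ?D + ?D ** S = 0"
      using eq by (simp add: vec_eq_iff matrix_matrix_mult_def algebra_simps sum_subtractf sum.distrib)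
    then have "0 = ?v \<bullet> ((R ** ?D + ?D ** S) *v ?v)"
      by simp
    also have "\<dots> = ?v \<bullet> (R *v (?D *v ?v)) + (?D *v ?v) \<bullet> (S *v ?v)"
      by (simp only: inner_matrix_vector_transpose D matrix_vector_mult_add_rdistrib inner_add_right
          matrix_vector_mul_assoc)
    also have "\<dots> = l i * (?v \<bullet> (R *v ?v) + ?v \<bullet> (S *v ?v))"
      by (simp only: ev matrix_vector_mult_scaleR) (simp add: algebra_simps)
    finally show ?thesis
      using pos by simp
  qed
  then have "diag_mat l = 0"
    by (simp add: diag_mat_def vec_eq_iff)
  then have "?D = 0"
    unfolding dec by simp
  then show ?thesis by simp
qed

text \<open>Justifies the definite description in \<open>mat_sqrt\<close>: roots of the eigenvalues
  give existence, \<open>pos_def_sqrt_unique\<close> gives uniqueness.\<close>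

lemma mat_sqrt:
  fixes X :: "real^'d^'d"
  assumes "X \<in> pos_def"
  shows mat_sqrt_pos_def: "mat_sqrt X \<in> pos_def" and mat_sqrt_square: "mat_sqrt X ** mat_sqrt X = X"
proof -
  obtain P l where P: "orthogonal_matrix P" and l: "\<And>i. 0 < l i"
    and X: "X = P ** diag_mat l ** transpose P"
    using pos_def_diagonalization[OF assms] by metis
  let ?R = "P ** diag_mat (\<lambda>i. sqrt (l i)) ** transpose P"
  have "invertible (transpose P)"
    using P by (auto simp: orthogonal_matrix_def invertible_def)
  moreover have "diag_mat (\<lambda>i. sqrt (l i)) \<in> pos_def"
    using l by (simp add: diag_mat_pos_def_iff)
  ultimately have R: "?R \<in> pos_def"
    using pos_def_congruence[of "diag_mat (\<lambda>i. sqrt (l i))" "transpose P"] by simp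
  have "?R ** ?R = P ** diag_mat (\<lambda>i. sqrt (l i)) ** (transpose P ** P) ** diag_mat (\<lambda>i. sqrt (l i)) ** transpose P"
    by (simp add: matrix_mul_assoc)
  also have "\<dots> = P ** (diag_mat (\<lambda>i. sqrt (l i)) ** diag_mat (\<lambda>i. sqrt (l i))) ** transpose P"
    using P by (simp add: orthogonal_matrix_def matrix_mul_assoc)
  also have "\<dots> = X"
    using l by (simp add: diag_mat_mult X less_imp_le)
  finally have "?R ** ?R = X" .
  then have "\<exists>!R. R \<in> pos_def \<and> R ** R = X"
    using R pos_def_sqrt_unique by (intro ex1I[of _ ?R]) auto
  then have "mat_sqrt X \<in> pos_def \<and> mat_sqrt X ** mat_sqrt X = X"
    unfolding mat_sqrt_def by (rule theI')
  then show "mat_sqrt X \<in> pos_def" "mat_sqrt X ** mat_sqrt X = X"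
    by auto
qed

lemma matrix_inv_mult:
  assumes "invertible A"
  shows matrix_inv_mult_right: "A ** matrix_inv A = mat 1"
    and matrix_inv_mult_left: "matrix_inv A ** A = mat 1"
  using assms someI_ex[of "\<lambda>A'. A ** A' = mat 1 \<and> A' ** A = mat 1"]
  by (auto simp: invertible_def matrix_inv_def)

text \<open>The inverse \<open>Y\<close> is a congruence of \<open>X\<close> itself, because
  \<open>transpose Y ** X ** Y = Y\<close>.\<close>

lemma matrix_inv_pos_def:
  fixes X :: "real^'d^'d"
  assumes "X \<in> pos_def"
  shows "matrix_inv X \<in> pos_def"
proof -
  let ?Y = "matrix_inv X"
  have X: "transpose X = X" and inv: "X ** ?Y = mat 1" "?Y ** X = mat 1"
    using assms matrix_inv_mult[OF invertible_pos_def] by (auto simp: pos_def_def)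
  have "transpose ?Y ** X = mat 1"
    using arg_cong[OF inv(1), of transpose] by (simp add: matrix_transpose_mul X)
  then have "transpose ?Y ** X ** ?Y = ?Y"
    by simp
  moreover have "invertible ?Y"
    using inv by (auto simp: invertible_def)
  ultimately show ?thesis
    using pos_def_congruence[OF assms, of ?Y] by simp
qed

lemma logdet_mult:
  assumes "0 < det X" "0 < det Y"
  shows "logdet (X ** Y) = logdet X + logdet Y"
  using assms by (simp add: logdet_def det_mul ln_mult)

text \<open>Positivity of \<open>det Y\<close> is read off from the product. This suits whitened
  matrices, whose own definiteness is not proved separately.\<close>

lemma logdet_add_eq:
  assumes eq: "det X * det Y = z" and pos: "0 < det X" "0 < z"
  shows "logdet X + logdet Y = ln z"
proof -
  have "0 < det Y"
    using zero_less_mult_pos[of "det X" "det Y"] pos by (simp add: eq)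
  then show ?thesis
    using pos by (simp add: logdet_def ln_mult flip: eq)
qed

text \<open>\<open>X ** Y\<close> may fail to be symmetric. With \<open>R\<close> the root of
  \<open>Y\<close>, the matrix \<open>R ** X ** R\<close> is positive definite and has the same
  determinant and trace, so \<open>logdet_le_trace\<close> applies to it.\<close>

lemma logdet_add_le_trace_mult:
  fixes X Y :: "real^'d^'d"
  assumes X: "X \<in> pos_def" and Y: "Y \<in> pos_def"
  shows "logdet X + logdet Y \<le> trace (X ** Y) - real CARD('d)"
proof -
  define R where "R = mat_sqrt Y"
  have R: "R \<in> pos_def" "R ** R = Y" "transpose R = R"
    using mat_sqrt[OF Y] by (auto simp: R_def pos_def_def)
  have "R ** X ** R \<in> pos_def"
    using pos_def_congruence[OF X invertible_pos_def[OF R(1)]] by (simp add: R(3))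
  from logdet_le_trace[OF this]
  have "logdet (R ** X ** R) \<le> trace (R ** X ** R) - real CARD('d)" .
  moreover have "det (R ** X ** R) = det (X ** Y)"
    by (simp add: det_mul flip: R(2))
  moreover have "trace (R ** X ** R) = trace (X ** Y)"
    by (metis R(2) matrix_mul_assoc trace_mul_sym)
  ultimately show ?thesis
    using logdet_mult[OF det_pos_def[OF X] det_pos_def[OF Y]] by (simp add: logdet_def)
qed

section \<open>Whitening and the objectives\<close>

lemma outer_mult_vec: "outer v *v w = (v \<bullet> w) *\<^sub>R v"
  by (simp add: outer_def matrix_vector_mult_def vec_eq_iff inner_vec_def sum_distrib_right
      sum_distrib_left mult_ac)

lemma congruence_outer: "R ** outer v ** transpose R = outer (R *v v)"
proof -
  have "(R ** outer v ** transpose R) *v w = outer (R *v v) *v w" for w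
    by (simp add: outer_mult_vec inner_matrix_vector_transpose matrix_vector_mult_scaleR
        flip: matrix_vector_mul_assoc)
  then show ?thesis
    by (simp add: matrix_eq)
qed

lemma congruence_sum_outer:
  fixes b :: "'n::finite \<Rightarrow> real^'d" and R :: "real^'d^'m"
  shows "R ** (\<Sum>i\<in>UNIV. x i *\<^sub>R outer (b i)) ** transpose R
    = (\<Sum>i\<in>UNIV. x i *\<^sub>R outer (R *v b i))"
proof -
  have lin: "linear (\<lambda>X. R ** X ** transpose R)"
    by (rule linearI)
       (simp_all add: vec_eq_iff matrix_matrix_mult_def sum.distrib sum_distrib_left
        sum_distrib_right algebra_simps)
  show ?thesis
    by (simp add: linear_sum[OF lin] linear_cmul[OF lin] congruence_outer)
qed

lemma transpose_add: "transpose (X + Y) = transpose X + transpose Y"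
  by (simp add: transpose_def vec_eq_iff)

lemma inner_sum_outer:
  fixes a :: "'n::finite \<Rightarrow> real^'d"
  shows "v \<bullet> ((\<Sum>i\<in>UNIV. x i *\<^sub>R outer (a i)) *v v) = (\<Sum>i\<in>UNIV. x i * (a i \<bullet> v)\<^sup>2)"
proof -
  have lin: "linear (\<lambda>X. v \<bullet> (X *v v))"
    by (rule linearI)
       (simp_all add: matrix_vector_mult_add_rdistrib inner_add_right flip: scaleR_matrix_vector_assoc)
  show ?thesis
    by (simp add: linear_sum[OF lin] linear_cmul[OF lin] outer_mult_vec power2_eq_square inner_commute)
qed

lemma transpose_sum_outer:
  fixes a :: "'n::finite \<Rightarrow> real^'d"
  shows "transpose (\<Sum>i\<in>UNIV. x i *\<^sub>R outer (a i)) = (\<Sum>i\<in>UNIV. x i *\<^sub>R outer (a i))"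
  by (simp add: transpose_def outer_def vec_eq_iff mult_ac)

lemma matrix_add_mult_distrib: "(X + Y) ** Z = X ** Z + Y ** (Z :: real^'n^'m)"
  by (simp add: vec_eq_iff matrix_matrix_mult_def distrib_right sum.distrib)

lemma pos_def_add_sum_outer:
  fixes a :: "'n::finite \<Rightarrow> real^'d"
  assumes "X \<in> pos_def" "\<And>i. 0 \<le> x i"
  shows "X + (\<Sum>i\<in>UNIV. x i *\<^sub>R outer (a i)) \<in> pos_def"
  using assms
  by (auto simp: pos_def_def transpose_add transpose_sum_outer matrix_vector_mult_add_rdistrib
      inner_add_right inner_sum_outer intro!: add_pos_nonneg sum_nonneg)

lemma gram_eq_sum_outer:
  fixes A :: "real^'n^'d"
  shows "A ** transpose A = (\<Sum>i\<in>UNIV. outer (column i A))"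
  by (simp add: vec_eq_iff matrix_matrix_mult_def transpose_def outer_def column_def)

text \<open>Undoes the whitening: conjugation by the root sends the identity to \<open>M\<close> and
  each whitened vector back to \<open>a i\<close>.\<close>

lemma mat_sqrt_congruence:
  fixes M :: "real^'d^'d" and a :: "'n::finite \<Rightarrow> real^'d"
  assumes M: "M \<in> pos_def"
  shows "mat_sqrt M ** (mat 1 + (\<Sum>i\<in>UNIV. x i *\<^sub>R outer (matrix_inv (mat_sqrt M) *v a i))) ** mat_sqrt M
    = M + (\<Sum>i\<in>UNIV. x i *\<^sub>R outer (a i))"
proof -
  let ?R = "mat_sqrt M"
  have R: "?R ** ?R = M" "transpose ?R = ?R" "?R ** matrix_inv ?R = mat 1"
    using mat_sqrt[OF M] matrix_inv_mult[OF invertible_pos_def] by (auto simp: pos_def_def)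
  have "?R ** (\<Sum>i\<in>UNIV. x i *\<^sub>R outer (matrix_inv ?R *v a i)) ** ?R
      = (\<Sum>i\<in>UNIV. x i *\<^sub>R outer (a i))"
    using congruence_sum_outer[of ?R x "\<lambda>i. matrix_inv ?R *v a i"]
    by (simp add: R matrix_vector_mul_assoc)
  then show ?thesis
    by (simp add: matrix_add_ldistrib matrix_add_mult_distrib R)
qed

text \<open>Serves both objectives: with coefficients \<open>x\<close> for \<open>M = C\<close>, and
  with \<open>- x\<close> for \<open>M = C + A ** transpose A\<close>.\<close>

lemma logdet_mat_sqrt_congruence:
  fixes M :: "real^'d^'d" and a :: "'n::finite \<Rightarrow> real^'d"
  assumes M: "M \<in> pos_def" and N: "M + (\<Sum>i\<in>UNIV. x i *\<^sub>R outer (a i)) \<in> pos_def"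
  shows "logdet M + logdet (mat 1 + (\<Sum>i\<in>UNIV. x i *\<^sub>R outer (matrix_inv (mat_sqrt M) *v a i)))
    = logdet (M + (\<Sum>i\<in>UNIV. x i *\<^sub>R outer (a i)))"
proof -
  let ?Y = "mat 1 + (\<Sum>i\<in>UNIV. x i *\<^sub>R outer (matrix_inv (mat_sqrt M) *v a i))"
  have "det M = det (mat_sqrt M) * det (mat_sqrt M)"
    using mat_sqrt_square[OF M] by (metis det_mul)
  then have "det M * det ?Y = det (M + (\<Sum>i\<in>UNIV. x i *\<^sub>R outer (a i)))"
    using arg_cong[OF mat_sqrt_congruence[OF M, of x a], of det] by (simp add: det_mul mult_ac)
  from logdet_add_eq[OF this det_pos_def[OF M] det_pos_def[OF N]] show ?thesis
    by (simp only: logdet_def[of "M + _"])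
qed

lemma obj_eq:
  fixes C :: "real^'d^'d" and A :: "real^'n^'d"
  assumes C: "C \<in> pos_def" and x: "\<And>i. 0 \<le> x $ i"
  shows "logdet C + obj C A x = logdet (C + (\<Sum>i\<in>UNIV. x $ i *\<^sub>R outer (column i A)))"
  using logdet_mat_sqrt_congruence[OF C pos_def_add_sum_outer[OF C x]]
  by (simp add: obj_def b_vec_def)

lemma pos_def_add_gram:
  fixes C :: "real^'d^'d" and A :: "real^'n^'d"
  assumes "C \<in> pos_def"
  shows "C + A ** transpose A \<in> pos_def"
  using pos_def_add_sum_outer[OF assms, of "\<lambda>_. 1" "\<lambda>i. column i A"]
  by (simp add: gram_eq_sum_outer)

text \<open>Taking weight \<open>x $ i\<close> from the full weight 1 leaves
  \<open>1 - x $ i\<close>. This is nonnegative, so the unwhitened matrix stays positive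
  definite.\<close>

lemma compl_obj_eq:
  fixes C :: "real^'d^'d" and A :: "real^'n^'d"
  assumes C: "C \<in> pos_def" and x: "\<And>i. x $ i \<le> 1"
  shows "logdet (C + A ** transpose A) + compl_obj C A x
    = logdet (C + (\<Sum>i\<in>UNIV. (1 - x $ i) *\<^sub>R outer (column i A)))"
proof -
  have eq: "C + A ** transpose A + (\<Sum>i\<in>UNIV. (- (x $ i)) *\<^sub>R outer (column i A))
      = C + (\<Sum>i\<in>UNIV. (1 - x $ i) *\<^sub>R outer (column i A))"
    by (simp add: gram_eq_sum_outer scaleR_diff_left sum_subtractf sum_negf)
  have "\<dots> \<in> pos_def"
    using x by (intro pos_def_add_sum_outer C) auto
  then have "logdet (C + A ** transpose A)
      + logdet (mat 1 + (\<Sum>i\<in>UNIV. (- (x $ i)) *\<^sub>R outer (q_vec C A i)))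
    = logdet (C + (\<Sum>i\<in>UNIV. (1 - x $ i) *\<^sub>R outer (column i A)))"
    using logdet_mat_sqrt_congruence[OF pos_def_add_gram[OF C, of A], where x = "\<lambda>i. - (x $ i)" and a = "\<lambda>i. column i A"]
    by (simp only: eq q_vec_def)
  then show ?thesis
    by (simp add: compl_obj_def sum_negf)
qed

section \<open>Complementation of binary vectors\<close>

lemma bij_betw_binary_vecs_complement:
  assumes "s \<le> CARD('n::finite)"
  shows "bij_betw (\<lambda>x. \<chi> i. 1 - x $ i) (binary_vecs s :: (real^'n) set) (binary_vecs (CARD('n) - s))"
proof -
  let ?c = "\<lambda>x. (\<chi> i. 1 - x $ i) :: real^'n"
  have "?c x \<in> binary_vecs (CARD('n) - k)" if x: "x \<in> binary_vecs k" and k: "k \<le> CARD('n)" for x k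
  proof -
    have "1 - x $ i \<in> {0, 1}" for i
      using x by (cases "x $ i = 0") (auto simp: binary_vecs_def)
    moreover have "(\<Sum>i\<in>UNIV. 1 - x $ i) = real (CARD('n) - k)"
      using x k by (simp add: binary_vecs_def sum_subtractf of_nat_diff)
    ultimately show ?thesis
      by (simp add: binary_vecs_def)
  qed
  \<comment> \<open>Complementation is its own inverse, so mapping in both directions suffices.
    \<open>s \<le> CARD('n)\<close> makes the truncated difference
    \<open>CARD('n) - (CARD('n) - s)\<close> equal to \<open>s\<close>.\<close>
  from this[of _ s] this[of _ "CARD('n) - s"] show ?thesis
    using assms by (intro bij_betw_byWitness[where f' = ?c]) auto
qed

text \<open>Together with \<open>binary_vecs_nonempty\<close>, this makes \<open>Max\<close> a true
  maximum and lets additive constants move through it.\<close>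

lemma finite_binary_vecs: "finite (binary_vecs k :: (real^'n) set)"
proof (rule finite_subset)
  show "binary_vecs k \<subseteq> (\<lambda>S. \<chi> i. of_bool (i \<in> S)) ` (UNIV :: 'n set set)"
  proof
    fix x :: "real^'n" assume "x \<in> binary_vecs k"
    then have "x = (\<chi> i. of_bool (i \<in> {i. x $ i = 1}))"
      by (auto simp: binary_vecs_def vec_eq_iff)
    then show "x \<in> (\<lambda>S. \<chi> i. of_bool (i \<in> S)) ` (UNIV :: 'n set set)"
      by blast
  qed
qed simp

lemma binary_vecs_nonempty:
  assumes "s \<le> CARD('n::finite)"
  shows "(binary_vecs s :: (real^'n) set) \<noteq> {}"
proof -
  obtain S :: "'n set" where "card S = s"
    using assms obtain_subset_with_card_n by metis
  then have "(\<chi> i. of_bool (i \<in> S)) \<in> binary_vecs s"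
    by (auto simp: binary_vecs_def)
  then show ?thesis by blast
qed

lemma obj_complement:
  fixes C :: "real^'d^'d" and A :: "real^'n^'d"
  assumes C: "C \<in> pos_def" and x: "x \<in> binary_vecs s"
  shows "logdet C + obj C A x = logdet (C + A ** transpose A) + compl_obj C A (\<chi> i. 1 - x $ i)"
proof -
  have "x $ i \<in> {0, 1}" for i
    using x by (simp add: binary_vecs_def)
  then have "0 \<le> x $ i" for i
    by (metis empty_iff insert_iff order_refl zero_le_one)
  then show ?thesis
    by (simp add: obj_eq[OF C] compl_obj_eq[OF C])
qed

lemma Max_obj_complement:
  fixes C :: "real^'d^'d" and A :: "real^'n^'d"
  assumes C: "C \<in> pos_def" and s: "s \<le> CARD('n)"
  shows "logdet C + Max (obj C A ` binary_vecs s)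
    = logdet (C + A ** transpose A) + Max (compl_obj C A ` binary_vecs (CARD('n) - s))"
proof -
  let ?B = "binary_vecs s :: (real^'n) set" and ?B' = "binary_vecs (CARD('n) - s) :: (real^'n) set"
  have img: "?B' = (\<lambda>x. \<chi> i. 1 - x $ i) ` ?B"
    by (rule bij_betw_imp_surj_on[OF bij_betw_binary_vecs_complement[OF s], symmetric])
  have "logdet C + Max (obj C A ` ?B) = Max ((\<lambda>x. obj C A x + logdet C) ` ?B)"
    using binary_vecs_nonempty[OF s] by (subst Max_add_commute) (auto simp: finite_binary_vecs)
  also have "(\<lambda>x. obj C A x + logdet C) ` ?B
      = (\<lambda>x. compl_obj C A x + logdet (C + A ** transpose A)) ` ?B'"
    unfolding img image_image using obj_complement[OF C] by (intro image_cong) (auto simp: add.commute)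
  also have "Max \<dots> = logdet (C + A ** transpose A) + Max (compl_obj C A ` ?B')"
    using binary_vecs_nonempty[where 'n = 'n, of "CARD('n) - s"]
    by (subst Max_add_commute) (auto simp: finite_binary_vecs)
  finally show ?thesis .
qed

section \<open>The Lagrangian dual\<close>

text \<open>The Lagrangian separates into a part in \<open>X\<close> and a linear part in the
  unrestricted \<open>x\<close>. The linear part is bounded above only if all its coefficients
  vanish, which is the condition on \<open>\<upsilon>\<close>.\<close>

lemma dual_fun_eq:
  fixes q :: "'n::finite \<Rightarrow> real^'d"
  assumes L: "\<Lambda> \<in> pos_def"
  shows "dual_fun q k \<Lambda> \<nu> \<upsilon> \<mu> =
    (if \<forall>i. \<upsilon> $ i = q i \<bullet> (\<Lambda> *v q i) + \<nu> + \<mu> $ i then ereal (dual_obj k (\<Lambda>, \<nu>, \<mu>)) else \<infinity>)"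
proof (cases "\<forall>i. \<upsilon> $ i = q i \<bullet> (\<Lambda> *v q i) + \<nu> + \<mu> $ i")
  case True
  have lag: "lagrangian q k X x \<Lambda> \<nu> \<upsilon> \<mu>
      = logdet X + trace \<Lambda> - trace (X ** \<Lambda>) + real k * \<nu> + (\<Sum>i\<in>UNIV. \<mu> $ i)" for X x
    by (simp add: lagrangian_def True)
  have "dual_fun q k \<Lambda> \<nu> \<upsilon> \<mu> = ereal (dual_obj k (\<Lambda>, \<nu>, \<mu>))"
  proof (rule antisym)
    show "dual_fun q k \<Lambda> \<nu> \<upsilon> \<mu> \<le> ereal (dual_obj k (\<Lambda>, \<nu>, \<mu>))"
      unfolding dual_fun_def
      by (intro SUP_least) (use logdet_add_le_trace_mult[OF _ L] in \<open>fastforce simp: lag dual_obj_def\<close>)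
    \<comment> \<open>Equality case of the trace bound: \<open>?X ** \<Lambda>\<close> is the
      identity, with trace \<open>CARD('d)\<close>, and the two values of \<open>logdet\<close>
      cancel.\<close>
    let ?X = "matrix_inv \<Lambda>"
    have X: "?X \<in> pos_def" "?X ** \<Lambda> = mat 1"
      using L matrix_inv_pos_def matrix_inv_mult_left invertible_pos_def by auto
    have "logdet ?X + logdet \<Lambda> = 0"
      using logdet_mult[OF det_pos_def[OF X(1)] det_pos_def[OF L]] by (simp add: X logdet_def)
    then have "lagrangian q k ?X 0 \<Lambda> \<nu> \<upsilon> \<mu> = dual_obj k (\<Lambda>, \<nu>, \<mu>)"
      by (simp add: lag dual_obj_def X trace_I)
    then show "ereal (dual_obj k (\<Lambda>, \<nu>, \<mu>)) \<le> dual_fun q k \<Lambda> \<nu> \<upsilon> \<mu>"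
      unfolding dual_fun_def using X(1) by (intro SUP_upper2[of "(?X, 0)"]) auto
  qed
  then show ?thesis
    using True by simp
next
  case False
  define c where "c i = - (q i \<bullet> (\<Lambda> *v q i)) - \<nu> + \<upsilon> $ i - \<mu> $ i" for i
  have "\<upsilon> $ i = q i \<bullet> (\<Lambda> *v q i) + \<nu> + \<mu> $ i \<longleftrightarrow> c i = 0" for i
    unfolding c_def by linarith
  then obtain i where i: "c i \<noteq> 0"
    using False by blast
  define l where "l = lagrangian q k (mat 1) 0 \<Lambda> \<nu> \<upsilon> \<mu>"
  \<comment> \<open>Along axis \<open>i\<close> the Lagrangian is affine with nonzero slope
    \<open>c i\<close>, hence unbounded above in one direction.\<close>
  have lag: "lagrangian q k (mat 1) (axis i t) \<Lambda> \<nu> \<upsilon> \<mu> = l + c i * t" for t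
  proof -
    have "(\<Sum>j\<in>UNIV. c j * axis i t $ j) = c i * t"
      by (simp add: axis_def if_distrib[of "\<lambda>x. _ * x"] cong: if_cong)
    then show ?thesis
      by (simp add: lagrangian_def l_def flip: c_def)
  qed
  have one: "mat 1 \<in> (pos_def :: (real^'d^'d) set)"
    by (simp add: pos_def_def transpose_mat)
  have "dual_fun q k \<Lambda> \<nu> \<upsilon> \<mu> = \<infinity>"
    unfolding dual_fun_def
  proof (rule SUP_PInfty)
    fix m :: nat
    \<comment> \<open>The coordinate is solved for so that the Lagrangian equals
      \<open>m\<close>.\<close>
    have "ereal (real m) \<le> ereal (lagrangian q k (mat 1) (axis i ((real m - l) / c i)) \<Lambda> \<nu> \<upsilon> \<mu>)"
      using i by (simp add: lag)
    then show "\<exists>p\<in>pos_def \<times> UNIV.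
        ereal (real m) \<le> (case p of (X, x) \<Rightarrow> ereal (lagrangian q k X x \<Lambda> \<nu> \<upsilon> \<mu>))"
      using one by (intro bexI[of _ "(mat 1, axis i ((real m - l) / c i))"]) auto
  qed
  then show ?thesis
    using False by simp
qed

text \<open>The vector on the right is the only \<open>\<upsilon>\<close> for which the dual
  function is finite; the constraints of the dual program ask that this forced multiplier be
  admissible.\<close>

lemma compl_dual_feasible_iff:
  "(\<Lambda>, \<nu>, \<mu>) \<in> compl_dual_feasible q \<longleftrightarrow> \<Lambda> \<in> pos_def \<and> \<mu> \<in> nonneg_vecs \<and>
    (\<chi> i. q i \<bullet> (\<Lambda> *v q i) + \<nu> + \<mu> $ i) \<in> nonneg_vecs"
proof -
  have "- x \<le> y + z \<longleftrightarrow> 0 \<le> x + y + z" for x y z :: real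
    by linarith
  then show ?thesis
    by (simp add: compl_dual_feasible_def nonneg_vecs_def)
qed

text \<open>At most one \<open>\<upsilon>\<close> contributes a finite value, so the infimum is that
  value if this \<open>\<upsilon>\<close> is nonnegative and infinite otherwise.\<close>

lemma INF_dual_fun:
  fixes q :: "'n::finite \<Rightarrow> real^'d"
  assumes L: "\<Lambda> \<in> pos_def" and mu: "\<mu> \<in> nonneg_vecs"
  shows "(INF \<upsilon> \<in> nonneg_vecs. dual_fun q k \<Lambda> \<nu> \<upsilon> \<mu>)
    = (if (\<Lambda>, \<nu>, \<mu>) \<in> compl_dual_feasible q then ereal (dual_obj k (\<Lambda>, \<nu>, \<mu>)) else \<infinity>)"
proof -
  let ?u = "\<chi> i. q i \<bullet> (\<Lambda> *v q i) + \<nu> + \<mu> $ i"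
  have feas: "(\<Lambda>, \<nu>, \<mu>) \<in> compl_dual_feasible q \<longleftrightarrow> ?u \<in> nonneg_vecs"
    using L mu by (simp add: compl_dual_feasible_iff)
  have eq: "dual_fun q k \<Lambda> \<nu> \<upsilon> \<mu> = (if \<upsilon> = ?u then ereal (dual_obj k (\<Lambda>, \<nu>, \<mu>)) else \<infinity>)" for \<upsilon>
    by (simp add: dual_fun_eq[OF L] vec_eq_iff)
  show ?thesis
  proof (cases "?u \<in> nonneg_vecs")
    case True
    then show ?thesis
      unfolding feas eq by (intro antisym) (auto intro!: INF_lower2[of ?u] INF_greatest)
  next
    case False
    then have "dual_fun q k \<Lambda> \<nu> \<upsilon> \<mu> = \<infinity>" if "\<upsilon> \<in> nonneg_vecs" for \<upsilon>
      using that eq by auto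
    then show ?thesis
      using False by (auto simp: feas INF_eq_iff simp flip: top_ereal_def)
  qed
qed

text \<open>A minimizer completed by its slack as \<open>\<upsilon>\<close> gives the upper bound;
  eliminating \<open>\<upsilon>\<close> at each other multiplier gives the lower bound.\<close>

lemma lagrangian_dual_eq:
  fixes q :: "'n::finite \<Rightarrow> real^'d"
  assumes "has_min (dual_obj k) (compl_dual_feasible q) v"
  shows "lagrangian_dual q k = ereal v"
proof (rule antisym)
  obtain \<Lambda> \<nu> \<mu> where p: "(\<Lambda>, \<nu>, \<mu>) \<in> compl_dual_feasible q" "dual_obj k (\<Lambda>, \<nu>, \<mu>) = v"
    using assms by (auto simp: has_min_def)
  let ?u = "\<chi> i. q i \<bullet> (\<Lambda> *v q i) + \<nu> + \<mu> $ i"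
  have "dual_fun q k \<Lambda> \<nu> ?u \<mu> = ereal v"
    using p by (simp add: dual_fun_eq compl_dual_feasible_def)
  moreover have "?u \<in> nonneg_vecs"
    using p by (simp add: compl_dual_feasible_iff)
  ultimately show "lagrangian_dual q k \<le> ereal v"
    unfolding lagrangian_dual_def using p
    by (intro INF_lower2[of "(\<Lambda>, \<nu>, ?u, \<mu>)"]) (auto simp: compl_dual_feasible_def)
next
  have "ereal v \<le> dual_fun q k \<Lambda> \<nu> \<upsilon> \<mu>"
    if "\<Lambda> \<in> pos_def" "\<upsilon> \<in> nonneg_vecs" "\<mu> \<in> nonneg_vecs" for \<Lambda> \<nu> \<upsilon> \<mu>
  proof -
    have "ereal v \<le> (INF \<upsilon> \<in> nonneg_vecs. dual_fun q k \<Lambda> \<nu> \<upsilon> \<mu>)"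
      using assms that by (simp add: INF_dual_fun has_min_def)
    also have "\<dots> \<le> dual_fun q k \<Lambda> \<nu> \<upsilon> \<mu>"
      using that by (intro INF_lower)
    finally show ?thesis .
  qed
  then show "ereal v \<le> lagrangian_dual q k"
    unfolding lagrangian_dual_def by (intro INF_greatest) auto
qed

text \<open>\<open>P\<close> is \<open>(C + A A\<^sup>T)\<^sup>1\<^sup>/\<^sup>2 C\<^sup>-\<^sup>1\<^sup>/\<^sup>2\<close>, so that \<open>\<Lambda> \<mapsto> P \<Lambda> P\<^sup>T\<close> matches the two whitened duals.\<close>

lemma whitening_change_of_basis:
  \<comment> \<open>the witness is \<open>P = (C + A A\<^sup>T)\<^bsup>1/2\<^esup> C\<^bsup>-1/2\<^esup>\<close>\<close>
  fixes C :: "real^'d^'d" and A :: "real^'n^'d"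
  assumes C: "C \<in> pos_def"
  obtains P where "invertible P" "\<And>i. transpose P *v q_vec C A i = b_vec C A i"
    "transpose P ** P = mat 1 + (\<Sum>i\<in>UNIV. outer (b_vec C A i))"
    "\<And>\<Lambda>. \<Lambda> \<in> pos_def \<Longrightarrow>
      logdet (C + A ** transpose A) + logdet \<Lambda> = logdet C + logdet (P ** \<Lambda> ** transpose P)"
proof -
  define M where "M = C + A ** transpose A"
  have M: "M \<in> pos_def"
    unfolding M_def by (rule pos_def_add_gram[OF C])
  define R where "R = mat_sqrt C"
  define S where "S = mat_sqrt M"
  define P where "P = S ** matrix_inv R"
  have R: "R \<in> pos_def" "R ** R = C" and S: "S \<in> pos_def" "S ** S = M"
    using mat_sqrt C M by (auto simp: R_def S_def)
  have inv: "R ** matrix_inv R = mat 1" "matrix_inv R ** R = mat 1"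
      "S ** matrix_inv S = mat 1"
    using R S matrix_inv_mult invertible_pos_def by auto
  have PT: "transpose P = matrix_inv R ** S"
    using matrix_inv_pos_def[OF R(1)] S(1) by (simp add: P_def matrix_transpose_mul pos_def_def)
  have "invertible P"
    unfolding P_def using R S matrix_inv_pos_def invertible_mult invertible_pos_def by blast
  moreover have "transpose P *v q_vec C A i = b_vec C A i" for i
  proof -
    have "matrix_inv R ** S ** matrix_inv S = matrix_inv R"
      by (simp add: inv flip: matrix_mul_assoc)
    then show ?thesis
      by (simp add: PT q_vec_def b_vec_def matrix_vector_mul_assoc flip: M_def R_def S_def)
  qed
  moreover have "transpose P ** P = mat 1 + (\<Sum>i\<in>UNIV. outer (b_vec C A i))"
  proof -
    let ?Y = "mat 1 + (\<Sum>i\<in>UNIV. outer (b_vec C A i))"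
    have Y: "R ** ?Y ** R = M"
      using mat_sqrt_congruence[OF C, of "\<lambda>_. 1" "\<lambda>i. column i A"]
      by (simp add: R_def M_def b_vec_def gram_eq_sum_outer)
    \<comment> \<open>Writing \<open>S ** S = M\<close> as \<open>R ** ?Y ** R\<close> lets both
      outer inverses of \<open>R\<close> cancel.\<close>
    have "transpose P ** P = matrix_inv R ** (S ** S) ** matrix_inv R"
      unfolding PT by (simp only: P_def matrix_mul_assoc)
    also have "\<dots> = (matrix_inv R ** R) ** ?Y ** (R ** matrix_inv R)"
      by (simp only: S(2) flip: Y) (simp only: matrix_mul_assoc)
    finally show ?thesis
      by (simp add: inv)
  qed
  moreover have "logdet M + logdet \<Lambda> = logdet C + logdet (P ** \<Lambda> ** transpose P)"
    if L: "\<Lambda> \<in> pos_def" for \<Lambda>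
  proof -
    \<comment> \<open>States without division that the square of \<open>det P\<close> is
      \<open>det M / det C\<close>; each factor \<open>det (matrix_inv R) * det R\<close> is
      1.\<close>
    have "det C * det (P ** \<Lambda> ** transpose P)
        = (det (matrix_inv R) * det R) * (det (matrix_inv R) * det R) * (det M * det \<Lambda>)"
      by (simp add: det_mul det_transpose P_def mult_ac flip: R(2) S(2))
    moreover have "det (matrix_inv R) * det R = 1"
      using arg_cong[OF inv(2), of det] by (simp add: det_mul)
    ultimately have "det C * det (P ** \<Lambda> ** transpose P) = det M * det \<Lambda>"
      by simp
    from logdet_add_eq[OF this det_pos_def[OF C]] show ?thesis
      using logdet_add_eq[OF refl det_pos_def[OF M], of \<Lambda>] det_pos_def[OF M] det_pos_def[OF L]
      by simp
  qed
  ultimately show thesis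
    using that unfolding M_def by blast
qed

text \<open>Only values matter: \<open>fwd\<close> carries the minimizer over, and
  \<open>bwd\<close> bounds every value on \<open>S'\<close> from below.\<close>

lemma has_min_transfer:
  assumes min: "has_min f S v"
    and fwd: "\<And>p. p \<in> S \<Longrightarrow> \<exists>p'\<in>S'. f' p' = f p + c"
    and bwd: "\<And>p'. p' \<in> S' \<Longrightarrow> \<exists>p\<in>S. f p + c = f' p'"
  shows "has_min f' S' (v + c)"
proof -
  obtain p where p: "p \<in> S" "f p = v" "\<And>p. p \<in> S \<Longrightarrow> v \<le> f p"
    using min by (auto simp: has_min_def)
  have "v + c \<le> f' p'" if "p' \<in> S'" for p'
    using bwd[OF that] p(3) by force
  then show ?thesis
    using fwd[OF p(1)] p(2) by (auto simp: has_min_def)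
qed

text \<open>With \<open>\<Lambda>' = P \<Lambda> P\<^sup>T\<close>, the substitution \<open>\<nu>' = -\<nu>\<close>, \<open>\<mu>'\<^sub>i = \<nu> + \<mu>\<^sub>i - b\<^sub>i\<^sup>T \<Lambda> b\<^sub>i\<close> is a bijection
  between the two feasible sets which exchanges the slack of the \<open>i\<close>-th constraint with the
  multiplier \<open>\<mu>\<^sub>i\<close> and shifts the objective by a constant; no duality theorem is needed.\<close>

lemma has_min_compl_dual:
  fixes C :: "real^'d^'d" and A :: "real^'n^'d"
  assumes C: "C \<in> pos_def" and s: "s \<le> CARD('n)"
    and min: "has_min (dual_obj s) (dual_feasible (b_vec C A)) w"
  shows "has_min (dual_obj (CARD('n) - s)) (compl_dual_feasible (q_vec C A))
    (w + (logdet C - logdet (C + A ** transpose A)))"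
proof -
  let ?b = "b_vec C A" and ?q = "q_vec C A"
  obtain P where P: "invertible P" "\<And>i. transpose P *v ?q i = ?b i"
    and PP: "transpose P ** P = mat 1 + (\<Sum>i\<in>UNIV. outer (?b i))"
    and ld: "\<And>\<Lambda>. \<Lambda> \<in> pos_def \<Longrightarrow>
      logdet (C + A ** transpose A) + logdet \<Lambda> = logdet C + logdet (P ** \<Lambda> ** transpose P)"
    using whitening_change_of_basis[OF C, of A] by blast
  have quad: "?q i \<bullet> ((P ** \<Lambda> ** transpose P) *v ?q i) = ?b i \<bullet> (\<Lambda> *v ?b i)" for i \<Lambda>
    using inner_matrix_vector_transpose[of "transpose P" "?q i" "\<Lambda> *v ?b i"]
    by (simp only: P(2) transpose_transpose flip: matrix_vector_mul_assoc)
  \<comment> \<open>By cyclicity of the trace and \<open>PP\<close>, the change of basis adds the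
    sum of all left-hand sides of the constraints.\<close>
  have tr: "trace (P ** \<Lambda> ** transpose P) = trace \<Lambda> + (\<Sum>i\<in>UNIV. ?b i \<bullet> (\<Lambda> *v ?b i))" for \<Lambda>
  proof -
    have "trace (P ** \<Lambda> ** transpose P) = trace ((transpose P ** P) ** \<Lambda>)"
      by (metis matrix_mul_assoc trace_mul_sym)
    then show ?thesis
      using trace_sum_scaleR_mult[of "\<lambda>_. 1" "\<lambda>i. outer (?b i)" \<Lambda>]
      by (simp add: PP matrix_add_mult_distrib trace_add trace_outer_mult)
  qed
  have PLP: "P ** \<Lambda> ** transpose P \<in> pos_def" if "\<Lambda> \<in> pos_def" for \<Lambda>
    using pos_def_congruence[OF that, of "transpose P"] P(1) by (simp add: invertible_det_nz)
  have n: "real (CARD('n) - s) = real CARD('n) - real s"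
    using s by (simp add: of_nat_diff)
  show ?thesis
  proof (rule has_min_transfer[OF min])
    fix p assume "p \<in> dual_feasible ?b"
    then obtain \<Lambda> \<nu> \<mu> where p: "p = (\<Lambda>, \<nu>, \<mu>)" and L: "\<Lambda> \<in> pos_def"
      and mu: "\<And>i. 0 \<le> \<mu> $ i" and feas: "\<And>i. ?b i \<bullet> (\<Lambda> *v ?b i) \<le> \<nu> + \<mu> $ i"
      by (auto simp: dual_feasible_def nonneg_vecs_def)
    \<comment> \<open>Summing the new third component contributes
      \<open>real CARD('n) * \<nu>\<close>, which turns \<open>- real (CARD('n) - s) * \<nu>\<close>
      into \<open>real s * \<nu>\<close>, and a negative sum that cancels the extra trace in
      \<open>tr\<close>.\<close>
    let ?p = "(P ** \<Lambda> ** transpose P, - \<nu>, \<chi> i. \<mu> $ i + \<nu> - ?b i \<bullet> (\<Lambda> *v ?b i))"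
    have "?p \<in> compl_dual_feasible ?q"
      using mu feas by (simp add: compl_dual_feasible_def nonneg_vecs_def PLP[OF L] quad add.commute)
    moreover have "dual_obj (CARD('n) - s) ?p
        = dual_obj s p + (logdet C - logdet (C + A ** transpose A))"
      using ld[OF L] by (simp add: dual_obj_def p tr n sum.distrib sum_subtractf algebra_simps)
    ultimately show "\<exists>p'\<in>compl_dual_feasible ?q.
        dual_obj (CARD('n) - s) p' = dual_obj s p + (logdet C - logdet (C + A ** transpose A))"
      by blast
  next
    fix p' assume "p' \<in> compl_dual_feasible ?q"
    then obtain \<Lambda>' \<nu> \<mu> where p: "p' = (\<Lambda>', \<nu>, \<mu>)" and L': "\<Lambda>' \<in> pos_def"
      and mu: "\<And>i. 0 \<le> \<mu> $ i" and feas: "\<And>i. - (?q i \<bullet> (\<Lambda>' *v ?q i)) \<le> \<nu> + \<mu> $ i"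
      by (auto simp: compl_dual_feasible_def nonneg_vecs_def)
    let ?Q = "matrix_inv P"
    define \<Lambda> where "\<Lambda> = ?Q ** \<Lambda>' ** transpose ?Q"
    have inv: "P ** ?Q = mat 1" "?Q ** P = mat 1"
      using P(1) matrix_inv_mult by auto
    have "invertible ?Q"
      using inv by (auto simp: invertible_def)
    then have L: "\<Lambda> \<in> pos_def"
      unfolding \<Lambda>_def using pos_def_congruence[OF L', of "transpose ?Q"]
      by (simp add: invertible_det_nz)
    have "P ** \<Lambda> ** transpose P = (P ** ?Q) ** \<Lambda>' ** transpose (P ** ?Q)"
      by (simp add: \<Lambda>_def matrix_transpose_mul matrix_mul_assoc)
    then have LP: "\<Lambda>' = P ** \<Lambda> ** transpose P"
      by (simp add: inv)
    \<comment> \<open>The new third component is the slack of the complementary constraint;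
      conversely, the slack of the new constraint is the old \<open>\<mu> $ i\<close>.\<close>
    let ?p = "(\<Lambda>, - \<nu>, \<chi> i. \<mu> $ i + \<nu> + ?b i \<bullet> (\<Lambda> *v ?b i))"
    have "0 \<le> \<mu> $ i + \<nu> + ?b i \<bullet> (\<Lambda> *v ?b i)" for i
      using feas[of i] unfolding LP quad by linarith
    then have "?p \<in> dual_feasible ?b"
      using mu L by (simp add: dual_feasible_def nonneg_vecs_def)
    moreover have "dual_obj s ?p + (logdet C - logdet (C + A ** transpose A))
        = dual_obj (CARD('n) - s) p'"
      using ld[OF L] by (simp add: dual_obj_def p LP tr n sum.distrib sum_subtractf algebra_simps)
    ultimately show "\<exists>p\<in>dual_feasible ?b.
        dual_obj s p + (logdet C - logdet (C + A ** transpose A)) = dual_obj (CARD('n) - s) p'"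
      by blast
  qed
qed

section \<open>Attainment of the dual minimum\<close>

text \<open>Nonnegative eigenvalues with nonzero product are positive. This recovers positive
  definiteness from conditions that survive limits once \<open>det\<close> is bounded away from
  0.\<close>

lemma pos_semidef_det_pos_imp_pos_def:
  fixes X :: "real^'d^'d"
  assumes sym: "transpose X = X" and psd: "\<And>v. 0 \<le> v \<bullet> (X *v v)" and det: "0 < det X"
  shows "X \<in> pos_def"
proof -
  obtain P l where P: "orthogonal_matrix P" and X: "X = P ** diag_mat l ** transpose P"
    using symmetric_matrix_diagonalization[OF sym] by blast
  have PP: "transpose P ** P = mat 1" "P ** transpose P = mat 1"
    using P by (auto simp: orthogonal_matrix_def)
  have "det X = (\<Prod>i\<in>UNIV. l i)"
    using det_orthogonal_matrix[OF P] by (auto simp: X det_mul det_transpose det_diag_mat)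
  then have "l i \<noteq> 0" for i
    using det by (metis UNIV_I finite less_irrefl prod_zero_iff)
  moreover have "0 \<le> l i" for i
  proof -
    let ?v = "P *v axis i 1"
    have "?v \<bullet> (X *v ?v) = axis i 1 \<bullet> ((transpose P ** P ** diag_mat l ** (transpose P ** P)) *v axis i 1)"
      by (simp add: X inner_matrix_vector_transpose matrix_vector_mul_assoc matrix_mul_assoc)
    then show ?thesis
      using psd[of ?v] by (simp add: PP inner_axis_diag_mat)
  qed
  ultimately have "diag_mat l \<in> pos_def"
    by (simp add: diag_mat_pos_def_iff less_le)
  moreover have "invertible (transpose P)"
    using PP by (auto simp: invertible_def)
  ultimately show ?thesis
    using pos_def_congruence[of "diag_mat l" "transpose P"] by (simp add: X)
qed

text \<open>Testing with the sum and the difference of two axis vectors bounds an entry by the mean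
  of two diagonal entries, each at most the trace.\<close>

lemma pos_semidef_entry_le_trace:
  fixes X :: "real^'d^'d"
  assumes sym: "transpose X = X" and psd: "\<And>v. 0 \<le> v \<bullet> (X *v v)"
  shows "\<bar>X $ i $ j\<bar> \<le> trace X"
proof -
  have entry: "axis i 1 \<bullet> (X *v axis j 1) = X $ i $ j" for i j
    by (simp add: inner_axis' matrix_vector_mult_basis column_def)
  have symij: "X $ j $ i = X $ i $ j"
    using sym by (metis transpose_def vec_lambda_beta)
  have nonneg: "0 \<le> X $ k $ k" for k
    using psd[of "axis k 1"] by (simp add: entry)
  have diag_le: "X $ k $ k \<le> trace X" for k
    unfolding trace_def using nonneg by (intro member_le_sum) auto
  have "0 \<le> X $ i $ i + X $ j $ j + 2 * X $ i $ j"
    using psd[of "axis i 1 + axis j 1"]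
    by (simp add: matrix_vector_right_distrib inner_add_left inner_add_right entry symij)
  moreover have "0 \<le> X $ i $ i + X $ j $ j - 2 * X $ i $ j"
    using psd[of "axis i 1 - axis j 1"]
    by (simp add: matrix_vector_mult_diff_distrib inner_diff_left inner_diff_right entry symij)
  ultimately show ?thesis
    using diag_le[of i] diag_le[of j] by linarith
qed

lemma bounded_matrix_entries:
  assumes "\<And>X i j. X \<in> S \<Longrightarrow> \<bar>X $ i $ j\<bar> \<le> T"
  shows "bounded (S :: (real^'n^'m) set)"
proof (rule boundedI)
  fix X assume X: "X \<in> S"
  have "norm X \<le> (\<Sum>i\<in>UNIV. norm (X $ i))"
    unfolding norm_vec_def by (rule L2_set_le_sum) simp
  also have "\<dots> \<le> (\<Sum>i\<in>UNIV. \<Sum>j\<in>UNIV. \<bar>X $ i $ j\<bar>)"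
    by (intro sum_mono norm_le_l1_cart)
  also have "\<dots> \<le> (\<Sum>i\<in>(UNIV::'m set). \<Sum>j\<in>(UNIV::'n set). T)"
    by (intro sum_mono assms X)
  finally show "norm X \<le> (\<Sum>i\<in>(UNIV::'m set). \<Sum>j\<in>(UNIV::'n set). T)" .
qed

lemma bounded_vec_entries:
  assumes "\<And>x i. x \<in> S \<Longrightarrow> \<bar>x $ i\<bar> \<le> T"
  shows "bounded (S :: (real^'n) set)"
proof (rule boundedI)
  fix x assume "x \<in> S"
  then have "(\<Sum>i\<in>UNIV. \<bar>x $ i\<bar>) \<le> (\<Sum>i\<in>(UNIV::'n set). T)"
    by (intro sum_mono assms)
  then show "norm x \<le> (\<Sum>i\<in>(UNIV::'n set). T)"
    using norm_le_l1_cart[of x] by linarith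
qed

text \<open>This and the next three rules let \<open>continuous_intros\<close> handle the closedness
  of \<open>K\<close> and the continuity of the objective in
  \<open>dual_attains_min\<close>.\<close>

lemma continuous_on_det [continuous_intros]:
  fixes f :: "'a::topological_space \<Rightarrow> real^'n^'n"
  assumes "continuous_on S f"
  shows "continuous_on S (\<lambda>x. det (f x))"
  unfolding det_def using assms by (intro continuous_intros) auto

lemma continuous_on_matrix_vector_mult [continuous_intros]:
  fixes f :: "'a::topological_space \<Rightarrow> real^'n^'m"
  assumes "continuous_on S f"
  shows "continuous_on S (\<lambda>x. f x *v v)"
  unfolding matrix_vector_mult_def using assms by (intro continuous_intros) auto

lemma continuous_on_trace [continuous_intros]:
  fixes f :: "'a::topological_space \<Rightarrow> real^'n^'n"
  assumes "continuous_on S f"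
  shows "continuous_on S (\<lambda>x. trace (f x))"
  unfolding trace_def using assms by (intro continuous_intros) auto

lemma continuous_on_transpose [continuous_intros]:
  fixes f :: "'a::topological_space \<Rightarrow> real^'n^'m"
  assumes "continuous_on S f"
  shows "continuous_on S (\<lambda>x. transpose (f x))"
  unfolding transpose_def using assms by (intro continuous_intros) auto

lemma pos_def_trace_nonneg:
  assumes "X \<in> pos_def"
  shows "0 \<le> trace X"
proof -
  have "0 \<le> v \<bullet> (X *v v)" for v
    using assms by (cases "v = 0") (auto simp: pos_def_def less_imp_le)
  then show ?thesis
    \<comment> \<open>Any entry will do: its absolute value is nonnegative and at most the
      trace.\<close>
    using pos_semidef_entry_le_trace[of X undefined undefined] assms by (force simp: pos_def_def)
qed

text \<open>Replacing \<open>\<nu> < 0\<close> by \<open>0\<close> and \<open>\<mu>\<^sub>i\<close> by \<open>\<nu> + \<mu>\<^sub>i\<close> does not increase the objective. Without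
  this step the objective is not coercive when \<open>s = n\<close>.\<close>

lemma dual_feasible_nonneg_multiplier:
  fixes b :: "'n::finite \<Rightarrow> real^'d"
  assumes p: "(\<Lambda>, \<nu>, \<mu>) \<in> dual_feasible b" and s: "s \<le> CARD('n)"
  shows "\<exists>\<nu>' \<mu>'. (\<Lambda>, \<nu>', \<mu>') \<in> dual_feasible b \<and> 0 \<le> \<nu>' \<and>
    dual_obj s (\<Lambda>, \<nu>', \<mu>') \<le> dual_obj s (\<Lambda>, \<nu>, \<mu>)"
proof (cases "0 \<le> \<nu>")
  case True
  then show ?thesis
    using p by blast
next
  case False
  have L: "\<Lambda> \<in> pos_def" and feas: "\<And>i. b i \<bullet> (\<Lambda> *v b i) \<le> \<nu> + \<mu> $ i"
    using p by (auto simp: dual_feasible_def)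
  have "0 \<le> b i \<bullet> (\<Lambda> *v b i)" for i
    using L by (cases "b i = 0") (auto simp: pos_def_def less_imp_le)
  then have "0 \<le> \<nu> + \<mu> $ i" for i
    using feas order_trans by blast
  then have "(\<Lambda>, 0, \<chi> i. \<nu> + \<mu> $ i) \<in> dual_feasible b"
    using L feas by (simp add: dual_feasible_def nonneg_vecs_def)
  moreover have "real CARD('n) * \<nu> \<le> real s * \<nu>"
    using False s by (intro mult_right_mono_neg) auto
  then have "dual_obj s (\<Lambda>, 0, \<chi> i. \<nu> + \<mu> $ i) \<le> dual_obj s (\<Lambda>, \<nu>, \<mu>)"
    by (simp add: dual_obj_def sum.distrib)
  ultimately show ?thesis
    by blast
qed

text \<open>Using \<open>logdet_le_trace\<close> at half of \<open>\<Lambda>\<close> costs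
  \<open>real CARD('d) * ln 2\<close> but keeps half of the trace, so a bound on the objective
  bounds the trace.\<close>

lemma half_trace_le_dual_obj:
  fixes \<Lambda> :: "real^'d^'d" and \<mu> :: "real^'n"
  assumes L: "\<Lambda> \<in> pos_def"
  shows "trace \<Lambda> / 2 - real CARD('d) * ln 2 + real s * \<nu> + (\<Sum>i\<in>UNIV. \<mu> $ i) \<le> dual_obj s (\<Lambda>, \<nu>, \<mu>)"
proof -
  have half: "(1 / 2) *\<^sub>R \<Lambda> \<in> pos_def"
    using L by (auto simp: pos_def_def transpose_def vec_eq_iff simp flip: scaleR_matrix_vector_assoc)
  have "(1 / 2) *\<^sub>R \<Lambda> = diag_mat (\<lambda>_. 1 / 2) ** \<Lambda>"
    by (simp add: vec_eq_iff diag_mat_def matrix_matrix_mult_def if_distrib[of "\<lambda>x. x * _"] cong: if_cong)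
  then have "det ((1 / 2) *\<^sub>R \<Lambda>) = (1 / 2) ^ CARD('d) * det \<Lambda>"
    by (simp only: det_mul det_diag_mat) simp
  then have "logdet ((1 / 2) *\<^sub>R \<Lambda>) = logdet \<Lambda> - real CARD('d) * ln 2"
    using det_pos_def[OF L] by (simp add: logdet_def ln_mult ln_realpow ln_div)
  moreover have "trace ((1 / 2) *\<^sub>R \<Lambda>) = trace \<Lambda> / 2"
    by (simp add: trace_def flip: sum_divide_distrib)
  ultimately show ?thesis
    using logdet_le_trace[OF half] by (simp add: dual_obj_def)
qed

lemma dual_attains_min:
  fixes b :: "'n::finite \<Rightarrow> real^'d"
  assumes s: "1 \<le> s" "s \<le> CARD('n)"
  shows "\<exists>w. has_min (dual_obj s) (dual_feasible b) w"
proof -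
  let ?f = "dual_obj s :: (real^'d^'d) \<times> real \<times> (real^'n) \<Rightarrow> real"
  have one: "mat 1 \<in> (pos_def :: (real^'d^'d) set)"
    by (simp add: pos_def_def transpose_mat)
  \<comment> \<open>Feasible reference point: the sum in the second component dominates each
    \<open>b i \<bullet> b i\<close>.\<close>
  define p0 :: "(real^'d^'d) \<times> real \<times> (real^'n)" where "p0 = (mat 1, \<Sum>i\<in>UNIV. b i \<bullet> b i, 0)"
  have p0: "p0 \<in> dual_feasible b" "0 \<le> fst (snd p0)"
    using one by (auto simp: p0_def dual_feasible_def nonneg_vecs_def intro!: member_le_sum sum_nonneg)
  define c where "c = ?f p0"
  \<comment> \<open>\<open>T\<close> comes from \<open>half_trace_le_dual_obj\<close> at level
    \<open>c\<close>; \<delta> comes from dropping the nonnegative terms of the objective and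
    solving for \<open>det\<close>.\<close>
  define T where "T = 2 * (c + real CARD('d) * ln 2)"
  define \<delta> where "\<delta> = exp (- c - real CARD('d))"
  \<comment> \<open>All conditions are closed: semidefiniteness with
    \<open>\<delta> \<le> det\<close> stands in for positive definiteness.\<close>
  define K :: "((real^'d^'d) \<times> real \<times> (real^'n)) set" where
    "K = {p. transpose (fst p) = fst p \<and> (\<forall>v. 0 \<le> v \<bullet> (fst p *v v)) \<and> \<delta> \<le> det (fst p) \<and>
      trace (fst p) \<le> T \<and> 0 \<le> fst (snd p) \<and> fst (snd p) \<le> c \<and>
      (\<forall>i. 0 \<le> snd (snd p) $ i \<and> snd (snd p) $ i \<le> c \<and>
        b i \<bullet> (fst p *v b i) \<le> fst (snd p) + snd (snd p) $ i)}"
  have K_feasible: "p \<in> dual_feasible b" if "p \<in> K" for p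
  proof -
    have "0 < \<delta>" by (simp add: \<delta>_def)
    then have "fst p \<in> pos_def"
      using that by (intro pos_semidef_det_pos_imp_pos_def) (auto simp: K_def)
    then show ?thesis
      using that by (auto simp: K_def dual_feasible_def nonneg_vecs_def split_beta)
  qed
  have sublevel_K: "(\<Lambda>, \<nu>, \<mu>) \<in> K"
    if p: "(\<Lambda>, \<nu>, \<mu>) \<in> dual_feasible b" "0 \<le> \<nu>" and le: "?f (\<Lambda>, \<nu>, \<mu>) \<le> c" for \<Lambda> \<nu> \<mu>
  proof -
    have L: "\<Lambda> \<in> pos_def" and mu: "\<And>i. 0 \<le> \<mu> $ i" and feas: "\<And>i. b i \<bullet> (\<Lambda> *v b i) \<le> \<nu> + \<mu> $ i"
      using p by (auto simp: dual_feasible_def nonneg_vecs_def)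
    have psd: "0 \<le> v \<bullet> (\<Lambda> *v v)" for v
      using L by (cases "v = 0") (auto simp: pos_def_def less_imp_le)
    \<comment> \<open>Here \<open>1 \<le> s\<close> enters: a bound on \<open>real s * \<nu>\<close>
      bounds \<open>\<nu>\<close>.\<close>
    have nu: "\<nu> \<le> real s * \<nu>"
      using p(2) s(1) by (simp add: mult_le_cancel_right1)
    have mui: "\<mu> $ i \<le> (\<Sum>i\<in>UNIV. \<mu> $ i)" for i
      using mu by (intro member_le_sum) auto
    have mus: "0 \<le> (\<Sum>i\<in>UNIV. \<mu> $ i)"
      using mu by (intro sum_nonneg) auto
    \<comment> \<open>The rest of the objective,
      \<open>- logdet \<Lambda> + trace \<Lambda> - real CARD('d)\<close>, is nonnegative.\<close>
    have "real s * \<nu> + (\<Sum>i\<in>UNIV. \<mu> $ i) \<le> c"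
      using le logdet_le_trace[OF L] by (simp add: dual_obj_def)
    then have "\<nu> \<le> c" "\<And>i. \<mu> $ i \<le> c"
      using nu mui mus p(2) by (auto intro: order_trans) (meson add_increasing nu order_trans)
    moreover have "trace \<Lambda> \<le> T"
      using half_trace_le_dual_obj[OF L, of s \<nu> \<mu>] le nu mus p(2) by (simp add: T_def)
    moreover have "\<delta> \<le> det \<Lambda>"
    proof -
      have "- c - real CARD('d) \<le> ln (det \<Lambda>)"
        using le nu mus p(2) pos_def_trace_nonneg[OF L] by (simp add: dual_obj_def logdet_def)
      then show ?thesis
        using det_pos_def[OF L] by (simp add: \<delta>_def ln_ge_iff)
    qed
    ultimately show ?thesis
      using L psd mu feas p(2) by (auto simp: K_def pos_def_def)
  qed
  have "closed K"
    unfolding K_def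
    by (intro closed_Collect_conj closed_Collect_all closed_Collect_eq closed_Collect_le continuous_intros)
  moreover have "bounded K"
  proof (rule bounded_subset)
    show "K \<subseteq> fst ` K \<times> {0..c} \<times> {\<mu>. \<forall>i. 0 \<le> \<mu> $ i \<and> \<mu> $ i \<le> c}"
      by (auto simp: K_def image_iff) metis
    have "bounded (fst ` K)"
      by (rule bounded_matrix_entries[of _ T])
         (auto simp: K_def intro: order_trans[OF pos_semidef_entry_le_trace])
    moreover have "bounded {\<mu> :: real^'n. \<forall>i. 0 \<le> \<mu> $ i \<and> \<mu> $ i \<le> c}"
      by (rule bounded_vec_entries[of _ c]) auto
    ultimately show "bounded (fst ` K \<times> {0..c} \<times> {\<mu> :: real^'n. \<forall>i. 0 \<le> \<mu> $ i \<and> \<mu> $ i \<le> c})"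
      by (intro bounded_Times bounded_closed_interval)
  qed
  ultimately have "compact K"
    by (simp add: compact_eq_bounded_closed)
  moreover have "p0 \<in> K"
    using p0 sublevel_K[of "fst p0" "fst (snd p0)" "snd (snd p0)"] by (simp add: c_def)
  moreover have "continuous_on K ?f"
  proof -
    have "det (fst p) \<noteq> 0" if "p \<in> K" for p
      using K_feasible[OF that] det_pos_def[of "fst p"] by (auto simp: dual_feasible_def split_beta)
    then show ?thesis
      unfolding dual_obj_def logdet_def split_beta by (intro continuous_intros) auto
  qed
  ultimately obtain p where p: "p \<in> K" "\<And>p'. p' \<in> K \<Longrightarrow> ?f p \<le> ?f p'"
    using continuous_attains_inf[of K ?f] by blast
  have "?f p \<le> ?f p'" if p'_feasible: "p' \<in> dual_feasible b" for p'
  proof -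
    obtain \<Lambda> \<nu> \<mu> where p': "p' = (\<Lambda>, \<nu>, \<mu>)"
      by (cases p')
    obtain \<nu>' \<mu>' where q: "(\<Lambda>, \<nu>', \<mu>') \<in> dual_feasible b" "0 \<le> \<nu>'"
      "?f (\<Lambda>, \<nu>', \<mu>') \<le> ?f p'"
      using dual_feasible_nonneg_multiplier[OF p'_feasible[unfolded p'] s(2)] unfolding p' by blast
    \<comment> \<open>Below level \<open>c\<close> the modified point lies in \<open>K\<close>;
      above it, comparison with \<open>p0\<close> suffices.\<close>
    show ?thesis
    proof (cases "?f (\<Lambda>, \<nu>', \<mu>') \<le> c")
      case True
      then show ?thesis
        using p(2)[OF sublevel_K[OF q(1,2)]] q(3) by simp
    next
      case False
      then show ?thesis
        using p(2)[OF \<open>p0 \<in> K\<close>] q(3) by (simp add: c_def)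
    qed
  qed
  then show ?thesis
    using K_feasible[OF p(1)] by (auto simp: has_min_def)
qed

text \<open>Eliminating \<open>\<upsilon>\<close> pointwise identifies the dual program itself and
  not merely its value; \<open>has_min\<close> records that both minima are attained.\<close>

theorem proposition7:
  fixes C :: "real^'d^'d" and A :: "real^'n^'d" and s :: nat
  assumes "C \<in> pos_def" and "1 \<le> s" and "s \<le> CARD('n)"
  shows
    "(bij_betw (\<lambda>x. \<chi> i. 1 - x $ i)
        (binary_vecs s :: (real^'n) set) (binary_vecs (CARD('n) - s))) \<and>
     (\<forall>x \<in> binary_vecs s.
        logdet C + obj C A x
          = logdet (C + A ** transpose A) + compl_obj C A (\<chi> i. 1 - x $ i)) \<and>
     (logdet C + Max (obj C A ` binary_vecs s)
        = logdet (C + A ** transpose A) + Max (compl_obj C A ` binary_vecs (CARD('n) - s))) \<and>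
     (\<forall>\<Lambda> \<in> pos_def. \<forall>\<nu>. \<forall>\<mu> \<in> nonneg_vecs.
        (INF \<upsilon> \<in> nonneg_vecs. dual_fun (q_vec C A) (CARD('n) - s) \<Lambda> \<nu> \<upsilon> \<mu>)
          = (if (\<Lambda>, \<nu>, \<mu>) \<in> compl_dual_feasible (q_vec C A)
             then ereal (dual_obj (CARD('n) - s) (\<Lambda>, \<nu>, \<mu>)) else \<infinity>)) \<and>
     (\<exists>v w.
        has_min (dual_obj (CARD('n) - s)) (compl_dual_feasible (q_vec C A)) v \<and>
        has_min (dual_obj s) (dual_feasible (b_vec C A)) w \<and>
        ereal (logdet (C + A ** transpose A)) + lagrangian_dual (q_vec C A) (CARD('n) - s)
          = ereal (logdet (C + A ** transpose A) + v) \<and>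
        logdet (C + A ** transpose A) + v = logdet C + w)"
proof -
  \<comment> \<open>Compactness supplies \<open>w\<close>; the complementary minimum is then
    \<open>w\<close> shifted by the difference of the two \<open>logdet\<close> constants.\<close>
  obtain w where w: "has_min (dual_obj s) (dual_feasible (b_vec C A)) w"
    using dual_attains_min[OF assms(2,3)] by blast
  note v = has_min_compl_dual[OF assms(1,3) w]
  show ?thesis
    using bij_betw_binary_vecs_complement[OF assms(3)] obj_complement[OF assms(1)]
      Max_obj_complement[OF assms(1,3)] w v lagrangian_dual_eq[OF v]
    by (intro conjI exI) (auto simp: INF_dual_fun)
qed

end
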